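(* The mother group $G_3$ and the direct product $G_3\times G_3\times G_3$ are commensurable: $G_3\approx G_3\times G_3\times G_3$.
   Context: Commensurability. Two groups $G$ and $H$ are commensurable (the paper writes "commeasurable"), denoted $G\approx H$, if there are subgroups $G'\subset G$ and $H'\subset H$ of finite index with $G'\simeq H'$. Rooted trees. Let $X=\{1,2,3\}$, and let $X^*$ be the set of finite words over $X$ (including the empty word $\emptyset$), viewed as the vertex set of the 3-regular rooted tree $T_3$ with root $\emptyset$, where $w$ and $wx$ are joined by an edge for $w\in X^*$, $x\in X$. $\mathrm{Aut}(T_3)=\mathrm{Aut}(X^* )$ is the group of bijections of $X^*$ preserving the root and adjacency. For $g\in\mathrm{Aut}(X^* )$ and $v\in X^*$, the restriction $g|_v$ is defined by $g(vw)=g(v)\,g|_v(w)$ for all $w\in X^*$. One writes $g=(g|_1,g|_2,g|_3)\sigma$, where $\sigma\in S_3$ is the action of $g$ on the first level $X$. Multiplication is $(g_1,g_2,g_3)\sigma\cdot(h_1,h_2,h_3)\tau=(g_1h_{\sigma(1)},g_2h_{\sigma(2)},g_3h_{\sigma(3)})\sigma\tau$; products of permutations and of automorphisms are read from left to right ($gh$ means first $g$, then $h$). Mother group $G_3$. Each $a\in S_3$ is regarded as the automorphism $a=(1,1,1)a$. Let $B_3=S_3\wr 2=S_3^2\rtimes S_2$; each $b=(b_1,b_2)\sigma\in B_3$ (with $b_1,b_2\in S_3$, $\sigma\in S_2$ acting on $\{1,2\}$ and extended to fix $3$) is regarded as the automorphism of $T_3$ defined recursively by $b=(b_1,b_2,b)\sigma$.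 $G_3$ is the subgroup of $\mathrm{Aut}(T_3)$ generated by the images of $S_3$ and $B_3$. *)

theory Defs
  imports "HOL-Algebra.Algebra" "HOL-Combinatorics.Permutations"
begin

section \<open>Commensurability\<close>

text \<open>Finite index is expressed by finiteness of the set of cosets, since \<^const>\<open>card\<close> is \<open>0\<close> on
  infinite sets.\<close>

definition commensurable :: "('a, 'c) monoid_scheme \<Rightarrow> ('b, 'd) monoid_scheme \<Rightarrow> bool" where
  "commensurable G H \<longleftrightarrow>
     (\<exists>G' H'. subgroup G' G \<and> finite (rcosets\<^bsub>G\<^esub> G') \<and>
              subgroup H' H \<and> finite (rcosets\<^bsub>H\<^esub> H') \<and>
              G\<lparr>carrier := G'\<rparr> \<cong> H\<lparr>carrier := H'\<rparr>)"


section \<open>The rooted tree and its automorphism group\<close>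

datatype letter = L1 | L2 | L3

text \<open>The vertices are the words over \<^typ>\<open>letter\<close>, with root the empty word; the first letter of a
  word is its first-level ancestor, and children are obtained by appending a letter at the end.\<close>

type_synonym vertex = "letter list"

definition adjacent :: "vertex \<Rightarrow> vertex \<Rightarrow> bool" where
  "adjacent u v \<longleftrightarrow> (\<exists>x. v = u @ [x]) \<or> (\<exists>x. u = v @ [x])"

text \<open>Products are read from left to right: \<open>g \<otimes> h\<close> is first \<open>g\<close>, then \<open>h\<close>.\<close>

definition Aut_T3 :: "(vertex \<Rightarrow> vertex) monoid" where
  "Aut_T3 = \<lparr>carrier = {g. bij g \<and> g [] = [] \<and> (\<forall>u v. adjacent (g u) (g v) \<longleftrightarrow> adjacent u v)},
             monoid.mult = (\<lambda>g h. h \<circ> g), one = id\<rparr>"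

text \<open>\<open>wreath f \<sigma>\<close> is the map written \<open>(f L1, f L2, f L3) \<sigma>\<close>: it acts on the first letter by \<open>\<sigma>\<close>,
  and its restriction at the first-level vertex \<open>x\<close> is \<open>f x\<close>.\<close>

primrec wreath :: "(letter \<Rightarrow> vertex \<Rightarrow> vertex) \<Rightarrow> (letter \<Rightarrow> letter) \<Rightarrow> vertex \<Rightarrow> vertex" where
  "wreath f \<sigma> [] = []"
| "wreath f \<sigma> (x # w) = \<sigma> x # f x w"

lemma wreath_mult:
  "wreath f \<sigma> \<otimes>\<^bsub>Aut_T3\<^esub> wreath h \<tau> = wreath (\<lambda>x. f x \<otimes>\<^bsub>Aut_T3\<^esub> h (\<sigma> x)) (\<tau> \<circ> \<sigma>)"
proof
  show "(wreath f \<sigma> \<otimes>\<^bsub>Aut_T3\<^esub> wreath h \<tau>) w =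
        wreath (\<lambda>x. f x \<otimes>\<^bsub>Aut_T3\<^esub> h (\<sigma> x)) (\<tau> \<circ> \<sigma>) w" for w
    by (cases w) (simp_all add: Aut_T3_def)
qed


section \<open>The mother group\<close>

definition rooted :: "(letter \<Rightarrow> letter) \<Rightarrow> vertex \<Rightarrow> vertex" where
  "rooted a = wreath (\<lambda>_. id) a"

primrec directed ::
  "(letter \<Rightarrow> letter) \<times> (letter \<Rightarrow> letter) \<times> (letter \<Rightarrow> letter) \<Rightarrow> vertex \<Rightarrow> vertex" where
  "directed b [] = []"
| "directed b (x # w) =
     (case b of (b1, b2, \<sigma>) \<Rightarrow>
        \<sigma> x # (case x of L1 \<Rightarrow> rooted b1 w | L2 \<Rightarrow> rooted b2 w | L3 \<Rightarrow> directed b w))"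

text \<open>\<^term>\<open>directed (b1, b2, \<sigma>)\<close> is the unique solution \<open>b\<close> of \<open>b = (b1, b2, b) \<sigma>\<close>.\<close>

lemma directed_unique:
  "b = wreath (case_letter (rooted b1) (rooted b2) b) \<sigma> \<longleftrightarrow> b = directed (b1, b2, \<sigma>)"
proof
  assume eq: "b = wreath (case_letter (rooted b1) (rooted b2) b) \<sigma>"
  have "b w = directed (b1, b2, \<sigma>) w" for w
  proof (induction w)
    case Nil
    show ?case by (subst eq) simp
  next
    case (Cons x w)
    then show ?case by (subst eq) (simp split: letter.split)
  qed
  then show "b = directed (b1, b2, \<sigma>)" by (rule ext)
next
  assume b: "b = directed (b1, b2, \<sigma>)"
  show "b = wreath (case_letter (rooted b1) (rooted b2) b) \<sigma>"
  proof
    show "b w = wreath (case_letter (rooted b1) (rooted b2) b) \<sigma> w" for w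
      unfolding b by (cases w) (simp_all split: letter.split)
  qed
qed

definition S3 :: "(letter \<Rightarrow> letter) set" where
  "S3 = {a. a permutes UNIV}"

text \<open>The elements of \<open>S\<^sub>3 \<wr> 2\<close> as triples \<open>(b1, b2, \<sigma>)\<close>; a map that permutes \<open>{L1, L2}\<close> in the
  sense of \<^const>\<open>permutes\<close> fixes \<^const>\<open>L3\<close>.\<close>

definition B3 :: "((letter \<Rightarrow> letter) \<times> (letter \<Rightarrow> letter) \<times> (letter \<Rightarrow> letter)) set" where
  "B3 = S3 \<times> S3 \<times> {\<sigma>. \<sigma> permutes {L1, L2}}"

definition mother_group :: "(vertex \<Rightarrow> vertex) monoid" where
  "mother_group = Aut_T3\<lparr>carrier := generate Aut_T3 (rooted ` S3 \<union> directed ` B3)\<rparr>"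


section \<open>Well-formedness\<close>

lemma group_Aut_T3: "group Aut_T3"
proof (rule groupI)
  fix g assume "g \<in> carrier Aut_T3"
  then have bij: "bij g" and root: "g [] = []"
    and adj: "adjacent (g u) (g v) \<longleftrightarrow> adjacent u v" for u v
    by (simp_all add: Aut_T3_def)
  define h where "h = inv_into UNIV g"
  have gh: "g (h v) = v" for v
    unfolding h_def by (rule surj_f_inv_f[OF bij_is_surj[OF bij]])
  have "h (g []) = []"
    unfolding h_def by (rule inv_f_f[OF bij_is_inj[OF bij]])
  moreover have "adjacent (h u) (h v) \<longleftrightarrow> adjacent u v" for u v
    using adj[of "h u" "h v"] by (simp only: gh)
  moreover have "bij h" unfolding h_def by (rule bij_imp_bij_inv[OF bij])
  ultimately have "h \<in> carrier Aut_T3" by (simp add: Aut_T3_def root)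
  moreover have "h \<otimes>\<^bsub>Aut_T3\<^esub> g = \<one>\<^bsub>Aut_T3\<^esub>" by (simp add: Aut_T3_def fun_eq_iff gh)
  ultimately show "\<exists>h\<in>carrier Aut_T3. h \<otimes>\<^bsub>Aut_T3\<^esub> g = \<one>\<^bsub>Aut_T3\<^esub>" by blast
qed (simp_all add: Aut_T3_def bij_comp comp_assoc)

lemma bij_wreath:
  assumes "bij \<sigma>" "\<And>x. bij (f x)"
  shows "bij (wreath f \<sigma>)"
proof (rule o_bij)
  let ?h = "wreath (\<lambda>y. inv_into UNIV (f (inv_into UNIV \<sigma> y))) (inv_into UNIV \<sigma>)"
  show "?h \<circ> wreath f \<sigma> = id"
  proof
    show "(?h \<circ> wreath f \<sigma>) w = id w" for w
      using assms by (cases w) (simp_all add: bij_is_inj)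
  qed
  show "wreath f \<sigma> \<circ> ?h = id"
  proof
    show "(wreath f \<sigma> \<circ> ?h) w = id w" for w
      using assms by (cases w) (simp_all add: bij_is_surj surj_f_inv_f)
  qed
qed

lemma adjacent_Nil [simp]:
  "adjacent [] v \<longleftrightarrow> length v = 1" "adjacent v [] \<longleftrightarrow> length v = 1"
  by (auto simp: adjacent_def length_Suc_conv)

lemma adjacent_Cons [simp]: "adjacent (x # u) (y # v) \<longleftrightarrow> x = y \<and> adjacent u v"
  by (auto simp: adjacent_def)

lemma rooted_in_Aut:
  assumes "a \<in> S3" shows "rooted a \<in> carrier Aut_T3"
proof -
  have a: "bij a" using assms by (simp add: S3_def permutes_bij)
  have "adjacent (rooted a u) (rooted a v) \<longleftrightarrow> adjacent u v" for u v
    by (cases u; cases v) (simp_all add: rooted_def bij_is_inj[OF a] inj_eq)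
  moreover have "bij (rooted a)" unfolding rooted_def by (rule bij_wreath) (simp_all add: a)
  ultimately show ?thesis by (simp add: Aut_T3_def rooted_def)
qed

lemma directed_in_Aut:
  assumes "b \<in> B3" shows "directed b \<in> carrier Aut_T3"
proof -
  obtain b1 b2 \<sigma> where b: "b = (b1, b2, \<sigma>)" and b12: "b1 \<in> S3" "b2 \<in> S3"
    and \<sigma>: "\<sigma> permutes {L1, L2}" using assms by (auto simp: B3_def)
  have inj: "inj \<sigma>" and surj: "surj \<sigma>"
    using \<sigma> by (simp_all add: permutes_inj permutes_surj)
  have R: "bij (rooted a)" "rooted a [] = []"
    "adjacent (rooted a u) (rooted a v) \<longleftrightarrow> adjacent u v" if "a \<in> S3" for a u v
    using rooted_in_Aut[OF that] by (simp_all add: Aut_T3_def)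
  note R1 = R[OF b12(1)] and R2 = R[OF b12(2)]
  have len: "length (directed b w) = length w" for w
  proof (induction w)
    case (Cons x w)
    have "length (rooted a v) = length v" for a v by (cases v) (simp_all add: rooted_def)
    with Cons show ?case by (simp add: b split: letter.split)
  qed simp
  have adj: "adjacent (directed b u) (directed b v) \<longleftrightarrow> adjacent u v" for u v
  proof (induction u arbitrary: v)
    case Nil
    show ?case by (simp add: len)
  next
    case (Cons x u)
    show ?case
    proof (cases v)
      case Nil
      have "length (directed b (x # u)) = length (x # u)" by (rule len)
      then show ?thesis by (simp only: Nil directed.simps(1) adjacent_Nil)
    next
      case v: (Cons y v')
      have IH: "adjacent (directed b u) (directed b v') \<longleftrightarrow> adjacent u v'" by (rule Cons.IH)
      show ?thesis
        using IH by (cases x; cases y) (simp_all add: v b inj_eq[OF inj] R1 R2)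
    qed
  qed
  have "inj (directed b)"
  proof (rule injI)
    fix u v assume "directed b u = directed b v"
    then show "u = v"
    proof (induction u arbitrary: v)
      case Nil
      then show ?case by (metis len length_0_conv)
    next
      case (Cons x u)
      then obtain y v' where v: "v = y # v'" by (metis len length_Suc_conv)
      have "x = y" using Cons.prems by (simp add: v b inj_eq[OF inj])
      then show ?case using Cons.prems Cons.IH[of v'] R1(1) R2(1)
        by (cases x) (auto simp: v b bij_is_inj inj_eq)
    qed
  qed
  moreover have "\<exists>u. directed b u = v" for v
  proof (induction v)
    case Nil
    show ?case by (rule exI[of _ "[]"]) simp
  next
    case (Cons y v)
    obtain x where x: "\<sigma> x = y" using surj by (metis surjD)
    have "\<exists>u. (case x of L1 \<Rightarrow> rooted b1 u | L2 \<Rightarrow> rooted b2 u | L3 \<Rightarrow> directed b u) = v"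
      using Cons.IH R1(1) R2(1) by (cases x) (simp_all, metis bij_pointE, metis bij_pointE)
    then obtain u where
      "(case x of L1 \<Rightarrow> rooted b1 u | L2 \<Rightarrow> rooted b2 u | L3 \<Rightarrow> directed b u) = v" ..
    with x show ?case by (intro exI[of _ "x # u"]) (cases x; simp add: b)
  qed
  then have "surj (directed b)" by (metis surjI someI_ex)
  ultimately show ?thesis using adj by (simp add: Aut_T3_def bij_def)
qed

lemma subgroup_mother_group: "subgroup (carrier mother_group) Aut_T3"
proof -
  interpret group Aut_T3 by (rule group_Aut_T3)
  have "rooted ` S3 \<union> directed ` B3 \<subseteq> carrier Aut_T3"
    using rooted_in_Aut directed_in_Aut by blast
  then show ?thesis by (simp add: mother_group_def generate_is_subgroup)
qed

lemma group_mother_group: "group mother_group"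
  using group.subgroup_imp_group[OF group_Aut_T3 subgroup_mother_group]
  by (simp add: mother_group_def)

end

theory Submission
  imports Defs
begin

text \<open>
  Let \<open>G\<close> be the mother group. An element of \<open>G\<close> that fixes the first level is determined by its
  triple of sections, which again lie in \<open>G\<close>; so the first level stabilizer, of index at most \<open>6\<close>
  in \<open>G\<close>, is isomorphic to the subgroup \<open>K\<close> of \<open>G\<^sup>3\<close> formed by the triples of sections. The two groups
  are commensurable because \<open>K\<close> has finite index in \<open>G\<^sup>3\<close>.

  To see this, let \<open>N\<close> consist of the \<open>n\<close> with \<open>(1, 1, n) \<in> K\<close>. Conjugation by rooted elements permutes
  the coordinates of \<open>K\<close>, so \<open>N\<^sup>3 \<subseteq> K\<close>, and it is enough that \<open>N\<close> has finite index in \<open>G\<close>. Removing the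
  permutation of the first level from \<open>b = (b1, b2, b) \<sigma>\<close> shows \<open>(b1, b2, b) \<in> K\<close> for every directed
  \<open>b\<close>. Two consequences follow. The projection of \<open>K\<close> to a coordinate is onto \<open>G\<close>, so \<open>N\<close> is normal
  in \<open>G\<close>. And the finite groups \<open>A\<close> of rooted and \<open>B\<close> of directed elements, which together generate
  \<open>G\<close>, commute modulo \<open>N\<close>: \<open>K\<close> contains triples with last coordinates \<open>a\<close> and \<open>b\<close> whose other
  coordinates commute, for \<open>b\<close> in a generating set of \<open>B\<close>, and the commutator of such triples is
  \<open>(1, 1, [a, b])\<close>
  (\<open>commutator_rooted_directed_mem_rigid\<close>). Hence \<open>G = N A B\<close>
  (\<open>carrier_subset_set_mult_if_commutators_mem\<close>), where \<open>A B\<close> is finite.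
\<close>

section \<open>Finite index from a transversal\<close>

lemma (in group) finite_rcosets_if_set_mult:
  assumes H: "subgroup H G" and R: "finite R" "R \<subseteq> carrier G"
    and cover: "carrier G \<subseteq> H <#> R"
  shows "finite (rcosets H)"
proof (rule finite_subset)
  show "rcosets H \<subseteq> (\<lambda>r. H #> r) ` R"
  proof
    fix C assume "C \<in> rcosets H"
    then obtain g where g: "g \<in> carrier G" "C = H #> g" by (auto simp: RCOSETS_def)
    then obtain h r where hr: "h \<in> H" "r \<in> R" "g = h \<otimes> r"
      using cover by (auto simp: set_mult_def)
    have "H #> (h \<otimes> r) = (H #> h) #> r"
      using H hr R by (simp add: coset_mult_assoc subgroup.mem_carrier subgroup.subset subsetD)
    also have "H #> h = H"
      using H hr by (simp add: subgroup.rcos_const is_group)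
    finally show "C \<in> (\<lambda>r. H #> r) ` R" using g hr by auto
  qed
qed (simp add: R)

lemma (in group) inv_cancel_left:
  assumes "u \<in> carrier G" "v \<in> carrier G"
  shows "inv u \<otimes> (u \<otimes> v) = v" "u \<otimes> (inv u \<otimes> v) = v"
  using assms by (simp_all add: m_assoc [symmetric])

text \<open>With \<open>[a, x] = a x a\<^sup>-\<^sup>1 x\<^sup>-\<^sup>1\<close> the identity behind this is \<open>[a, x y] = [a, x] \<cdot> x [a, y] x\<^sup>-\<^sup>1\<close>.\<close>

lemma (in normal) commutator_mult_right_mem:
  assumes a: "a \<in> carrier G" and x: "x \<in> carrier G" "a \<otimes> x \<otimes> inv a \<otimes> inv x \<in> H"
    and y: "y \<in> carrier G" "a \<otimes> y \<otimes> inv a \<otimes> inv y \<in> H"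
  shows "a \<otimes> (x \<otimes> y) \<otimes> inv a \<otimes> inv (x \<otimes> y) \<in> H"
proof -
  have "a \<otimes> (x \<otimes> y) \<otimes> inv a \<otimes> inv (x \<otimes> y) =
      (a \<otimes> x \<otimes> inv a \<otimes> inv x) \<otimes> (x \<otimes> (a \<otimes> y \<otimes> inv a \<otimes> inv y) \<otimes> inv x)"
    using a x(1) y(1) by (simp add: m_assoc inv_mult_group inv_cancel_left)
  then show ?thesis
    using inv_op_closed2[OF x(1) y(2)] x(2) by simp
qed

text \<open>In the quotient by \<open>H\<close> the images of \<open>A\<close> and \<open>B\<close> commute, so the product of the two images is a
  subgroup, and it contains the generators. Below this is expressed as stability of \<open>H A B\<close> under right
  multiplication by generators.\<close>

lemma (in normal) carrier_subset_set_mult_if_commutators_mem: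
  assumes A: "subgroup A G" and B: "subgroup B G"
    and gen: "carrier G = generate G (A \<union> B)"
    and comm: "\<And>a b. a \<in> A \<Longrightarrow> b \<in> B \<Longrightarrow> a \<otimes> b \<otimes> inv a \<otimes> inv b \<in> H"
  shows "carrier G \<subseteq> H <#> (A <#> B)"
proof
  let ?P = "H <#> (A <#> B)"
  have Ac: "a \<in> carrier G" if "a \<in> A" for a using A that by (rule subgroup.mem_carrier)
  have Bc: "b \<in> carrier G" if "b \<in> B" for b using B that by (rule subgroup.mem_carrier)
  have Pc: "g \<in> carrier G" if "g \<in> ?P" for g using that by (auto simp: set_mult_def Ac Bc)
  have PI: "n \<otimes> (a \<otimes> b) \<in> ?P" if "n \<in> H" "a \<in> A" "b \<in> B" for n a b
    using that by (auto simp: set_mult_def)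
  have step: "g \<otimes> s \<in> ?P" if g: "g \<in> ?P" and s: "s \<in> A \<union> B" for g s
  proof -
    obtain n a b where nab: "n \<in> H" "a \<in> A" "b \<in> B" "g = n \<otimes> (a \<otimes> b)"
      using g by (auto simp: set_mult_def)
    note c = mem_carrier[OF nab(1)] Ac[OF nab(2)] Bc[OF nab(3)]
    show ?thesis
    proof (cases "s \<in> B")
      case True
      then have "g \<otimes> s = n \<otimes> (a \<otimes> (b \<otimes> s))" using nab(4) c Bc by (simp add: m_assoc)
      then show ?thesis using PI[OF nab(1,2)] subgroup.m_closed[OF B nab(3) True] by simp
    next
      case False
      then have sA: "s \<in> A" using s by simp
      note sc = Ac[OF sA]
      \<comment> \<open>moving \<open>s\<close> to the left past \<open>b\<close> costs an element of \<open>H\<close>, which is absorbed on the left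
        after conjugation by \<open>a\<close>\<close>
      define k where "k = s \<otimes> b \<otimes> inv s \<otimes> inv b"
      have k: "inv k \<in> H" unfolding k_def by (rule m_inv_closed, rule comm[OF sA nab(3)])
      have kb: "b \<otimes> s = inv k \<otimes> (s \<otimes> b)"
        unfolding k_def using c sc by (simp add: inv_mult_group m_assoc inv_cancel_left)
      have "g \<otimes> s = n \<otimes> (a \<otimes> (b \<otimes> s))" using nab(4) c sc by (simp add: m_assoc)
      also have "\<dots> = (n \<otimes> (a \<otimes> inv k \<otimes> inv a)) \<otimes> ((a \<otimes> s) \<otimes> b)"
        unfolding kb using c sc mem_carrier[OF k] by (simp add: m_assoc inv_cancel_left)
      also have "\<dots> \<in> ?P"
        using nab sA inv_op_closed2[OF c(2) k] subgroup.m_closed[OF A] by (intro PI) auto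
      finally show ?thesis .
    qed
  qed
  have closed: "\<forall>g\<in>?P. g \<otimes> h \<in> ?P" if "h \<in> generate G (A \<union> B)" for h
    using that
  proof (induction h rule: generate.induct)
    case one
    then show ?case using Pc by simp
  next
    case (incl h)
    then show ?case using step by blast
  next
    case (inv h)
    then have "inv h \<in> A \<union> B" using subgroup.m_inv_closed[OF A] subgroup.m_inv_closed[OF B] by blast
    then show ?case using step by blast
  next
    case (eng h1 h2)
    then show ?case using Pc by (metis gen m_assoc)
  qed
  fix g assume g: "g \<in> carrier G"
  have "\<one> \<otimes> (\<one> \<otimes> \<one>) \<in> ?P"
    using A B by (intro PI) (simp_all add: subgroup.one_closed)
  then show "g \<in> ?P" using closed[of g] g gen by fastforce
qed


section \<open>Calculations in the mother group\<close>

abbreviation "M \<equiv> mother_group"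

interpretation M: group M by (rule group_mother_group)

lemma M_mult: "g \<otimes>\<^bsub>M\<^esub> h = h \<circ> g"
  by (simp add: mother_group_def Aut_T3_def)

lemma M_one: "\<one>\<^bsub>M\<^esub> = id"
  by (simp add: mother_group_def Aut_T3_def)

lemma M_generate: "carrier M = generate M (rooted ` S3 \<union> directed ` B3)"
proof -
  let ?X = "rooted ` S3 \<union> directed ` B3"
  have "?X \<subseteq> carrier M" by (auto simp: mother_group_def intro: generate.incl)
  from group.generate_consistent[OF group_Aut_T3 this subgroup_mother_group]
  show ?thesis by (simp add: mother_group_def)
qed

lemma rooted_mem: "a \<in> S3 \<Longrightarrow> rooted a \<in> carrier M"
  by (simp add: M_generate generate.incl)

lemma directed_mem: "b \<in> B3 \<Longrightarrow> directed b \<in> carrier M"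
  by (simp add: M_generate generate.incl)

lemma S3_iff_bij: "a \<in> S3 \<longleftrightarrow> bij a"
  by (auto simp: S3_def permutes_bij intro: bij_imp_permutes)

lemma bij_comp_inv: "bij a \<Longrightarrow> a \<circ> inv_into UNIV a = id" "bij a \<Longrightarrow> inv_into UNIV a \<circ> a = id"
  using surj_iff bij_is_surj by (auto simp: bij_is_inj)

lemma wreath_mult_M:
  "wreath f \<sigma> \<otimes>\<^bsub>M\<^esub> wreath h \<tau> = wreath (\<lambda>x. f x \<otimes>\<^bsub>M\<^esub> h (\<sigma> x)) (\<tau> \<circ> \<sigma>)"
  using wreath_mult[of f \<sigma> h \<tau>] by (simp add: mother_group_def)

lemma wreath_one: "wreath (\<lambda>_. \<one>\<^bsub>M\<^esub>) id = \<one>\<^bsub>M\<^esub>"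
proof
  show "wreath (\<lambda>_. \<one>\<^bsub>M\<^esub>) id w = \<one>\<^bsub>M\<^esub> w" for w by (cases w) (simp_all add: M_one)
qed

lemma wreath_eq_iff: "wreath f \<sigma> = wreath h \<tau> \<longleftrightarrow> f = h \<and> \<sigma> = \<tau>"
proof
  assume eq: "wreath f \<sigma> = wreath h \<tau>"
  have "\<sigma> x # f x w = \<tau> x # h x w" for x w using fun_cong[OF eq, of "x # w"] by simp
  then show "f = h \<and> \<sigma> = \<tau>" by (auto simp: fun_eq_iff)
qed simp

lemma rooted_eq_wreath: "rooted a = wreath (\<lambda>_. \<one>\<^bsub>M\<^esub>) a"
  by (simp add: rooted_def M_one id_def)

lemma wreath_mult_rooted:
  "(\<And>x. f x \<in> carrier M) \<Longrightarrow> wreath f \<sigma> \<otimes>\<^bsub>M\<^esub> rooted \<tau> = wreath f (\<tau> \<circ> \<sigma>)"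
  by (simp add: rooted_eq_wreath wreath_mult_M)

lemma directed_eq_wreath:
  "directed (b1, b2, \<sigma>) = wreath (case_letter (rooted b1) (rooted b2) (directed (b1, b2, \<sigma>))) \<sigma>"
  using directed_unique by blast

lemma rooted_mult: "rooted a \<otimes>\<^bsub>M\<^esub> rooted b = rooted (b \<circ> a)"
  by (simp add: rooted_eq_wreath wreath_mult_M)

lemma rooted_id: "rooted id = \<one>\<^bsub>M\<^esub>"
  by (simp add: rooted_eq_wreath wreath_one)

lemma rooted_comp_apply: "rooted (\<lambda>x. b (a x)) w = rooted b (rooted a w)"
  using rooted_mult[of a b] by (simp add: M_mult fun_eq_iff o_def)

lemma rooted_id_apply: "rooted (\<lambda>x. x) w = w"
  using rooted_id by (simp add: M_one id_def)

text \<open>\<open>directed\<close> maps the wreath product of \<open>S3\<close> with the permutations of \<open>{L1, L2}\<close> homomorphically to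
  \<open>M\<close>. The two possible values of the first permutation give the two product rules.\<close>

lemma directed_mult_id:
  "directed (b1, b2, id) \<otimes>\<^bsub>M\<^esub> directed (c1, c2, \<tau>) = directed (c1 \<circ> b1, c2 \<circ> b2, \<tau>)"
proof
  show "(directed (b1, b2, id) \<otimes>\<^bsub>M\<^esub> directed (c1, c2, \<tau>)) w = directed (c1 \<circ> b1, c2 \<circ> b2, \<tau>) w" for w
  proof (induction w)
    case (Cons x w)
    then show ?case by (cases x; simp add: M_mult rooted_comp_apply)
  qed (simp add: M_mult)
qed

lemma directed_mult_transpose:
  "directed (b1, b2, transpose L1 L2) \<otimes>\<^bsub>M\<^esub> directed (c1, c2, \<tau>) =
     directed (c2 \<circ> b1, c1 \<circ> b2, \<tau> \<circ> transpose L1 L2)"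
proof
  show "(directed (b1, b2, transpose L1 L2) \<otimes>\<^bsub>M\<^esub> directed (c1, c2, \<tau>)) w =
      directed (c2 \<circ> b1, c1 \<circ> b2, \<tau> \<circ> transpose L1 L2) w" for w
  proof (induction w)
    case (Cons x w)
    then show ?case by (cases x; simp add: M_mult rooted_comp_apply)
  qed (simp add: M_mult)
qed

lemma directed_id: "directed (id, id, id) = \<one>\<^bsub>M\<^esub>"
proof
  show "directed (id, id, id) w = \<one>\<^bsub>M\<^esub> w" for w
    by (induction w) (simp_all add: rooted_id_apply M_one split: letter.split)
qed

lemma permutes_L1_L2_iff: "\<sigma> permutes {L1, L2} \<longleftrightarrow> \<sigma> = id \<or> \<sigma> = transpose L1 L2"
  by (simp add: permutes_doubleton_iff)

lemma subgroup_rooted: "subgroup (rooted ` S3) M"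
proof (rule M.subgroupI)
  show "inv\<^bsub>M\<^esub> g \<in> rooted ` S3" if g: "g \<in> rooted ` S3" for g
  proof -
    obtain a where a: "a \<in> S3" "g = rooted a" using g by blast
    have i: "inv_into UNIV a \<in> S3" using a by (simp add: S3_iff_bij bij_imp_bij_inv)
    have "rooted (inv_into UNIV a) \<otimes>\<^bsub>M\<^esub> g = \<one>\<^bsub>M\<^esub>"
      using a by (simp add: rooted_mult S3_iff_bij bij_comp_inv rooted_id)
    then have "inv\<^bsub>M\<^esub> g = rooted (inv_into UNIV a)"
      using a i by (simp add: M.inv_equality rooted_mem)
    with i show ?thesis by simp
  qed
  have "id \<in> S3" by (simp add: S3_iff_bij)
  then show "rooted ` S3 \<noteq> {}" by blast
qed (auto simp: rooted_mem rooted_mult S3_iff_bij intro!: imageI bij_comp)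

lemma subgroup_directed: "subgroup (directed ` B3) M"
proof (rule M.subgroupI)
  show "directed ` B3 \<noteq> {}" by (auto simp: B3_def S3_def intro: permutes_id)
  show "inv\<^bsub>M\<^esub> g \<in> directed ` B3" if g: "g \<in> directed ` B3" for g
  proof -
    obtain b1 b2 \<sigma> where b: "b1 \<in> S3" "b2 \<in> S3" "\<sigma> permutes {L1, L2}" "g = directed (b1, b2, \<sigma>)"
      using g by (auto simp: B3_def)
    let ?i = "inv_into UNIV"
    \<comment> \<open>the inverse permutes the two rooted sections along with the first level\<close>
    define c where "c = (if \<sigma> = id then (?i b1, ?i b2, \<sigma>) else (?i b2, ?i b1, \<sigma>))"
    have c: "c \<in> B3" using b by (simp add: c_def B3_def S3_iff_bij bij_imp_bij_inv)
    have "directed c \<otimes>\<^bsub>M\<^esub> g = \<one>\<^bsub>M\<^esub>"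
      using b by (auto simp: c_def permutes_L1_L2_iff S3_iff_bij bij_comp_inv directed_mult_id
          directed_mult_transpose directed_id)
    moreover have "g \<in> carrier M" using b by (auto simp: B3_def intro: directed_mem)
    ultimately have "inv\<^bsub>M\<^esub> g = directed c" using c by (simp add: M.inv_equality directed_mem)
    with c show ?thesis by simp
  qed
  show "g \<otimes>\<^bsub>M\<^esub> h \<in> directed ` B3" if "g \<in> directed ` B3" "h \<in> directed ` B3" for g h
    using that
    by (auto simp: B3_def S3_iff_bij permutes_L1_L2_iff directed_mult_id directed_mult_transpose
        intro!: imageI bij_comp)
qed (auto simp: directed_mem)

lemma finite_S3: "finite S3"
proof -
  have "finite (UNIV :: letter set)"
    by (rule finite_subset[of _ "{L1, L2, L3}"]) (auto intro: letter.exhaust)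
  then show ?thesis unfolding S3_def by (rule finite_permutations)
qed

lemma finite_B3: "finite B3"
  by (simp add: B3_def finite_S3 finite_permutations)

text \<open>The restrictions of the generators are generators or trivial, and a restriction of a product is a
  product of restrictions.\<close>

lemma self_similar:
  assumes "g \<in> carrier M"
  obtains f \<sigma> where "g = wreath f \<sigma>" "\<And>x. f x \<in> carrier M" "\<sigma> \<in> S3"
proof -
  have gens: "\<exists>f \<sigma>. g = wreath f \<sigma> \<and> (\<forall>x. f x \<in> carrier M) \<and> \<sigma> \<in> S3"
    if g: "g \<in> rooted ` S3 \<union> directed ` B3" for g
  proof (cases "g \<in> rooted ` S3")
    case True
    then show ?thesis by (auto simp: rooted_eq_wreath)
  next
    case False
    then obtain b1 b2 \<sigma> where b: "g = directed (b1, b2, \<sigma>)" "(b1, b2, \<sigma>) \<in> B3" using g by auto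
    then have "\<sigma> \<in> S3" "b1 \<in> S3" "b2 \<in> S3" by (auto simp: B3_def S3_iff_bij permutes_bij)
    moreover have "case_letter (rooted b1) (rooted b2) (directed (b1, b2, \<sigma>)) x \<in> carrier M" for x
      using b calculation by (cases x) (simp_all add: rooted_mem directed_mem)
    ultimately show ?thesis using b(1) directed_eq_wreath by metis
  qed
  have mult: "\<exists>f \<sigma>. g \<otimes>\<^bsub>M\<^esub> h = wreath f \<sigma> \<and> (\<forall>x. f x \<in> carrier M) \<and> \<sigma> \<in> S3"
    if "\<exists>f \<sigma>. g = wreath f \<sigma> \<and> (\<forall>x. f x \<in> carrier M) \<and> \<sigma> \<in> S3"
      "\<exists>f \<sigma>. h = wreath f \<sigma> \<and> (\<forall>x. f x \<in> carrier M) \<and> \<sigma> \<in> S3" for g h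
    using that by (auto simp: wreath_mult_M wreath_eq_iff S3_iff_bij intro: bij_comp)
  have "\<exists>f \<sigma>. g = wreath f \<sigma> \<and> (\<forall>x. f x \<in> carrier M) \<and> \<sigma> \<in> S3"
    using assms unfolding M_generate
  proof (induction g rule: generate.induct)
    case one
    show ?case by (metis M.one_closed M_generate rooted_id rooted_eq_wreath S3_iff_bij bij_id)
  next
    case (incl h)
    then show ?case by (metis M_generate gens)
  next
    case (inv h)
    then have "inv\<^bsub>M\<^esub> h \<in> rooted ` S3 \<union> directed ` B3"
      using subgroup.m_inv_closed[OF subgroup_rooted] subgroup.m_inv_closed[OF subgroup_directed]
      by blast
    then show ?case by (metis M_generate gens)
  next
    case (eng h1 h2)
    then show ?case using mult M_generate by simp
  qed
  then show thesis using that by blast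
qed


section \<open>The first level stabilizer\<close>

text \<open>The first level stabilizer as seen through the restrictions of its elements. Families indexed by
  letters make coordinatewise products and the action of \<open>S3\<close> on coordinates easy to write.\<close>

definition sections :: "(letter \<Rightarrow> vertex \<Rightarrow> vertex) set" where
  "sections = {f. wreath f id \<in> carrier M}"

lemma sections_mem: "f \<in> sections \<Longrightarrow> f x \<in> carrier M"
  unfolding sections_def using self_similar wreath_eq_iff by (metis mem_Collect_eq)

lemma sections_one: "(\<lambda>_. \<one>\<^bsub>M\<^esub>) \<in> sections"
  by (simp add: sections_def wreath_one)

lemma sections_mult: "f \<in> sections \<Longrightarrow> h \<in> sections \<Longrightarrow> (\<lambda>x. f x \<otimes>\<^bsub>M\<^esub> h x) \<in> sections"
  unfolding sections_def using M.m_closed[of "wreath f id" "wreath h id"] by (simp add: wreath_mult_M)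

lemma inv_wreath_id:
  assumes "f \<in> sections"
  shows "inv\<^bsub>M\<^esub> (wreath f id) = wreath (\<lambda>x. inv\<^bsub>M\<^esub> f x) id"
proof -
  obtain h \<sigma> where h: "inv\<^bsub>M\<^esub> (wreath f id) = wreath h \<sigma>" "\<And>x. h x \<in> carrier M"
    using self_similar[OF M.inv_closed[of "wreath f id"]] assms unfolding sections_def by blast
  have "wreath (\<lambda>x. f x \<otimes>\<^bsub>M\<^esub> h x) \<sigma> = wreath (\<lambda>_. \<one>\<^bsub>M\<^esub>) id"
    using assms wreath_mult_M[of f id h \<sigma>] M.r_inv[of "wreath f id"]
    by (simp add: h(1) wreath_one sections_def)
  then have "\<sigma> = id" "(\<lambda>x. f x \<otimes>\<^bsub>M\<^esub> h x) = (\<lambda>_. \<one>\<^bsub>M\<^esub>)"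
    by (simp_all only: wreath_eq_iff)
  then have "\<sigma> = id" "f x \<otimes>\<^bsub>M\<^esub> h x = \<one>\<^bsub>M\<^esub>" for x
    by (simp_all add: fun_eq_iff)
  then have "\<sigma> = id" "h x = inv\<^bsub>M\<^esub> f x" for x
    using h(2) sections_mem[OF assms]
    by (simp_all add: M.inv_equality[symmetric, OF M.inv_comm])
  then show ?thesis using h(1) by presburger
qed

lemma sections_inv: "f \<in> sections \<Longrightarrow> (\<lambda>x. inv\<^bsub>M\<^esub> f x) \<in> sections"
  using inv_wreath_id[of f] by (metis (mono_tags) M.inv_closed mem_Collect_eq sections_def)

text \<open>Conjugation of \<open>wreath f id\<close> by the rooted element \<open>a\<close> relabels its restrictions by \<open>a\<close>.\<close>

lemma sections_permute:
  assumes "f \<in> sections" "a \<in> S3"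
  shows "f \<circ> a \<in> sections"
proof -
  have i: "inv_into UNIV a \<in> S3" using assms by (simp add: S3_iff_bij bij_imp_bij_inv)
  have "inv_into UNIV a \<circ> a = id" using assms by (simp add: S3_iff_bij bij_is_inj)
  then have "rooted a \<otimes>\<^bsub>M\<^esub> wreath f id \<otimes>\<^bsub>M\<^esub> rooted (inv_into UNIV a) = wreath (f \<circ> a) id"
    using sections_mem[OF assms(1)] by (simp add: rooted_eq_wreath wreath_mult_M o_def)
  moreover have "rooted a \<otimes>\<^bsub>M\<^esub> wreath f id \<otimes>\<^bsub>M\<^esub> rooted (inv_into UNIV a) \<in> carrier M"
    using assms i by (simp add: rooted_mem sections_def)
  ultimately show ?thesis by (simp add: sections_def)
qed

text \<open>Multiplying \<open>b = (b1, b2, b) \<sigma>\<close> by the rooted element \<open>\<sigma>\<^sup>-\<^sup>1\<close> yields an element of \<open>M\<close> that fixes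
  the first level and has the same restrictions.\<close>

lemma sections_directed:
  assumes "(b1, b2, \<sigma>) \<in> B3"
  shows "case_letter (rooted b1) (rooted b2) (directed (b1, b2, \<sigma>)) \<in> sections"
proof -
  let ?f = "case_letter (rooted b1) (rooted b2) (directed (b1, b2, \<sigma>))"
  have b: "bij \<sigma>" "b1 \<in> S3" "b2 \<in> S3" using assms by (auto simp: B3_def permutes_bij)
  have i: "inv_into UNIV \<sigma> \<in> S3" using b by (simp add: S3_iff_bij bij_imp_bij_inv)
  have f: "?f x \<in> carrier M" for x
    using b assms by (cases x) (simp_all add: rooted_mem directed_mem)
  have "directed (b1, b2, \<sigma>) \<otimes>\<^bsub>M\<^esub> rooted (inv_into UNIV \<sigma>) =
      wreath ?f \<sigma> \<otimes>\<^bsub>M\<^esub> rooted (inv_into UNIV \<sigma>)"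
    by (rule arg_cong[OF directed_eq_wreath])
  also have "\<dots> = wreath ?f id"
    using wreath_mult_rooted[of ?f, OF f] bij_comp_inv(2)[OF b(1)] by simp
  finally have "wreath ?f id = directed (b1, b2, \<sigma>) \<otimes>\<^bsub>M\<^esub> rooted (inv_into UNIV \<sigma>)" ..
  then show ?thesis using assms i by (simp add: sections_def rooted_mem directed_mem)
qed

text \<open>The directed generators occur at \<open>L3\<close> by their definition. A rooted generator \<open>a\<close> occurs at \<open>L1\<close>
  in \<open>(a, 1, directed (a, 1, 1))\<close> and is moved to \<open>L3\<close> by permuting coordinates.\<close>

lemma sections_L3_surj:
  assumes "g \<in> carrier M"
  obtains f where "f \<in> sections" "f L3 = g"
proof -
  have gens: "\<exists>f\<in>sections. f L3 = g" if g: "g \<in> rooted ` S3 \<union> directed ` B3" for g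
  proof (cases "g \<in> directed ` B3")
    case True
    then obtain b1 b2 \<sigma> where b: "g = directed (b1, b2, \<sigma>)" "(b1, b2, \<sigma>) \<in> B3" by auto
    then show ?thesis by (intro bexI[OF _ sections_directed[OF b(2)]]) simp
  next
    case False
    then obtain a where a: "a \<in> S3" "g = rooted a" using g by blast
    then have "(a, id, id) \<in> B3" by (simp add: B3_def S3_iff_bij permutes_id)
    from sections_permute[OF sections_directed[OF this], of "transpose L1 L3"]
    have "case_letter (rooted a) (rooted id) (directed (a, id, id)) \<circ> transpose L1 L3 \<in> sections"
      by (simp add: S3_iff_bij)
    then show ?thesis by (rule bexI[rotated]) (simp add: a)
  qed
  have "\<exists>f\<in>sections. f L3 = g"
    using assms unfolding M_generate
  proof (induction g rule: generate.induct)
    case one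
    show ?case by (rule bexI[OF _ sections_one]) simp
  next
    case (incl h)
    then show ?case by (rule gens)
  next
    case (inv h)
    from gens[OF inv] obtain f where f: "f \<in> sections" "f L3 = h" by (elim bexE)
    then show ?case by (intro bexI[OF _ sections_inv[OF f(1)]]) simp
  next
    case (eng h1 h2)
    from eng.IH obtain f1 f2
      where f: "f1 \<in> sections" "f1 L3 = h1" "f2 \<in> sections" "f2 L3 = h2" by (elim bexE)
    then show ?case by (intro bexI[OF _ sections_mult[OF f(1,3)]]) simp
  qed
  then show thesis by (elim bexE) (rule that)
qed


section \<open>The rigid stabilizer of a first level vertex\<close>

text \<open>This is the group of elements of \<open>M\<close> acting only below the vertex \<open>L3\<close>, identified with their
  restrictions at \<open>L3\<close>.\<close>

definition rigid :: "(vertex \<Rightarrow> vertex) set" where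
  "rigid = {n. (\<lambda>_. \<one>\<^bsub>M\<^esub>)(L3 := n) \<in> sections}"

lemma rigid_mem: "n \<in> rigid \<Longrightarrow> n \<in> carrier M"
  unfolding rigid_def using sections_mem[of _ L3] by fastforce

text \<open>Normality in all of \<open>M\<close> holds because every \<open>g\<close> in \<open>M\<close> is the restriction at \<open>L3\<close> of some \<open>f\<close> in
  \<open>sections\<close>: conjugating \<open>(1, 1, n)\<close> by \<open>f\<close> leaves the first two coordinates trivial.\<close>

lemma normal_rigid: "rigid \<lhd> M"
proof (rule M.normal_invI)
  show "subgroup rigid M"
  proof (rule M.subgroupI)
    show "rigid \<subseteq> carrier M" using rigid_mem by blast
    have "\<one>\<^bsub>M\<^esub> \<in> rigid" using sections_one by (simp add: rigid_def fun_upd_idem)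
    then show "rigid \<noteq> {}" by blast
    show "inv\<^bsub>M\<^esub> n \<in> rigid" if "n \<in> rigid" for n
    proof -
      have "(\<lambda>x. inv\<^bsub>M\<^esub> ((\<lambda>_. \<one>\<^bsub>M\<^esub>)(L3 := n)) x) = (\<lambda>_. \<one>\<^bsub>M\<^esub>)(L3 := inv\<^bsub>M\<^esub> n)" by auto
      then show ?thesis using sections_inv[of "(\<lambda>_. \<one>\<^bsub>M\<^esub>)(L3 := n)"] that by (simp add: rigid_def)
    qed
    show "m \<otimes>\<^bsub>M\<^esub> n \<in> rigid" if "m \<in> rigid" "n \<in> rigid" for m n
    proof -
      have "(\<lambda>x. ((\<lambda>_. \<one>\<^bsub>M\<^esub>)(L3 := m)) x \<otimes>\<^bsub>M\<^esub> ((\<lambda>_. \<one>\<^bsub>M\<^esub>)(L3 := n)) x) =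
          (\<lambda>_. \<one>\<^bsub>M\<^esub>)(L3 := m \<otimes>\<^bsub>M\<^esub> n)" by auto
      then show ?thesis
        using sections_mult[of "(\<lambda>_. \<one>\<^bsub>M\<^esub>)(L3 := m)" "(\<lambda>_. \<one>\<^bsub>M\<^esub>)(L3 := n)"] that
        by (simp add: rigid_def)
    qed
  qed
  show "g \<otimes>\<^bsub>M\<^esub> n \<otimes>\<^bsub>M\<^esub> inv\<^bsub>M\<^esub> g \<in> rigid" if g: "g \<in> carrier M" and n: "n \<in> rigid" for g n
  proof -
    obtain f where f: "f \<in> sections" "f L3 = g" using sections_L3_surj[OF g] by blast
    have "(\<lambda>x. f x \<otimes>\<^bsub>M\<^esub> ((\<lambda>_. \<one>\<^bsub>M\<^esub>)(L3 := n)) x \<otimes>\<^bsub>M\<^esub> inv\<^bsub>M\<^esub> f x) =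
        (\<lambda>_. \<one>\<^bsub>M\<^esub>)(L3 := g \<otimes>\<^bsub>M\<^esub> n \<otimes>\<^bsub>M\<^esub> inv\<^bsub>M\<^esub> g)"
      by (rule ext) (use f(2) sections_mem[OF f(1)] in auto)
    moreover have "(\<lambda>x. f x \<otimes>\<^bsub>M\<^esub> ((\<lambda>_. \<one>\<^bsub>M\<^esub>)(L3 := n)) x \<otimes>\<^bsub>M\<^esub> inv\<^bsub>M\<^esub> f x) \<in> sections"
      using n f(1) by (intro sections_mult sections_inv) (simp only: rigid_def mem_Collect_eq)+
    ultimately show ?thesis by (simp add: rigid_def)
  qed
qed

lemma commutator_mem_rigid:
  assumes "f \<in> sections" "h \<in> sections"
    and "\<And>x. x \<noteq> L3 \<Longrightarrow> f x \<otimes>\<^bsub>M\<^esub> h x = h x \<otimes>\<^bsub>M\<^esub> f x"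
  shows "f L3 \<otimes>\<^bsub>M\<^esub> h L3 \<otimes>\<^bsub>M\<^esub> inv\<^bsub>M\<^esub> f L3 \<otimes>\<^bsub>M\<^esub> inv\<^bsub>M\<^esub> h L3 \<in> rigid"
proof -
  let ?c = "\<lambda>x. f x \<otimes>\<^bsub>M\<^esub> h x \<otimes>\<^bsub>M\<^esub> inv\<^bsub>M\<^esub> f x \<otimes>\<^bsub>M\<^esub> inv\<^bsub>M\<^esub> h x"
  have "?c x = \<one>\<^bsub>M\<^esub>" if "x \<noteq> L3" for x
    using assms(3)[OF that] sections_mem[OF assms(1)] sections_mem[OF assms(2)]
    by (simp add: M.m_assoc)
  then have "?c = (\<lambda>_. \<one>\<^bsub>M\<^esub>)(L3 := ?c L3)" by auto
  moreover have "?c \<in> sections"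
    using assms by (intro sections_mult sections_inv)
  ultimately show ?thesis unfolding rigid_def by simp
qed

text \<open>Write \<open>b = (b1, 1, 1) (1, b2, 1) (1, 1, \<sigma>)\<close> in the wreath product. Each factor \<open>c\<close> has at most
  one nontrivial restriction besides \<open>c\<close> itself, so \<open>a\<close> at \<open>L3\<close> can be completed to a family in
  \<open>sections\<close> that is trivial wherever this restriction sits. The two families then commute away from
  \<open>L3\<close>. For \<open>b\<close> itself no such family is at hand if \<open>b1\<close> and \<open>b2\<close> are both nontrivial, hence the
  factorization.\<close>

lemma commutator_rooted_directed_mem_rigid:
  assumes a: "a \<in> S3" and b: "b \<in> B3"
  shows "rooted a \<otimes>\<^bsub>M\<^esub> directed b \<otimes>\<^bsub>M\<^esub> inv\<^bsub>M\<^esub> rooted a \<otimes>\<^bsub>M\<^esub> inv\<^bsub>M\<^esub> directed b \<in> rigid"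
proof -
  obtain b1 b2 \<sigma> where b': "b = (b1, b2, \<sigma>)" by (cases b)
  have id: "id \<in> S3" by (simp add: S3_iff_bij)
  have B: "(a, id, id) \<in> B3" "(b1, id, id) \<in> B3" "(id, b2, id) \<in> B3" "(id, id, \<sigma>) \<in> B3"
    using a b id by (simp_all add: B3_def b' permutes_id)
  \<comment> \<open>from \<open>(a, 1, d)\<close> permuting coordinates gives \<open>(d, 1, a)\<close> and \<open>(1, d, a)\<close>, which carry \<open>a\<close> at
    \<open>L3\<close> and leave either one of the other coordinates free\<close>
  define d where "d = directed (a, id, id)"
  have d: "d \<in> carrier M" "rooted a \<in> carrier M" using B a by (simp_all add: d_def directed_mem rooted_mem)
  have s1: "case_letter (rooted a) \<one>\<^bsub>M\<^esub> d \<in> sections"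
    using sections_directed[OF B(1)] by (simp add: rooted_id d_def)
  have s2: "case_letter d \<one>\<^bsub>M\<^esub> (rooted a) \<in> sections"
  proof -
    have "case_letter (rooted a) \<one>\<^bsub>M\<^esub> d \<circ> transpose L1 L3 = case_letter d \<one>\<^bsub>M\<^esub> (rooted a)"
      by (auto simp: fun_eq_iff transpose_def split: letter.split)
    then show ?thesis using sections_permute[OF s1, of "transpose L1 L3"] by (simp add: S3_iff_bij)
  qed
  have s3: "case_letter \<one>\<^bsub>M\<^esub> d (rooted a) \<in> sections"
  proof -
    have "case_letter d \<one>\<^bsub>M\<^esub> (rooted a) \<circ> transpose L1 L2 = case_letter \<one>\<^bsub>M\<^esub> d (rooted a)"
      by (auto simp: fun_eq_iff transpose_def split: letter.split)
    then show ?thesis using sections_permute[OF s2, of "transpose L1 L2"] by (simp add: S3_iff_bij)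
  qed
  let ?comm = "\<lambda>g. rooted a \<otimes>\<^bsub>M\<^esub> g \<otimes>\<^bsub>M\<^esub> inv\<^bsub>M\<^esub> rooted a \<otimes>\<^bsub>M\<^esub> inv\<^bsub>M\<^esub> g \<in> rigid"
  have r: "rooted b1 \<in> carrier M" "rooted b2 \<in> carrier M"
    using b by (simp_all add: B3_def b' rooted_mem)
  have "?comm (directed (b1, id, id))"
    using commutator_mem_rigid[OF s3 sections_directed[OF B(2)]] d r
    by (simp add: rooted_id split: letter.split)
  moreover have "?comm (directed (id, b2, id))"
    using commutator_mem_rigid[OF s2 sections_directed[OF B(3)]] d r
    by (simp add: rooted_id split: letter.split)
  moreover have "?comm (directed (id, id, \<sigma>))"
    using commutator_mem_rigid[OF s2 sections_directed[OF B(4)]] d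
    by (simp add: rooted_id split: letter.split)
  ultimately have "?comm (directed (b1, id, id) \<otimes>\<^bsub>M\<^esub> (directed (id, b2, id) \<otimes>\<^bsub>M\<^esub> directed (id, id, \<sigma>)))"
    using B d by (intro normal.commutator_mult_right_mem[OF normal_rigid]) (simp_all add: directed_mem)
  then show ?thesis by (simp add: b' directed_mult_id)
qed

lemma rigid_transversal:
  obtains R where "finite R" "R \<subseteq> carrier M" "carrier M \<subseteq> rigid <#>\<^bsub>M\<^esub> R"
proof
  let ?R = "rooted ` S3 <#>\<^bsub>M\<^esub> directed ` B3"
  show "finite ?R" by (auto simp: set_mult_def finite_S3 finite_B3)
  show "?R \<subseteq> carrier M" by (auto simp: set_mult_def rooted_mem directed_mem)
  show "carrier M \<subseteq> rigid <#>\<^bsub>M\<^esub> ?R"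
    by (rule normal.carrier_subset_set_mult_if_commutators_mem[OF normal_rigid subgroup_rooted
          subgroup_directed M_generate]) (auto intro: commutator_rooted_directed_mem_rigid)
qed

lemma rigid_cube_sections:
  assumes "n1 \<in> rigid" "n2 \<in> rigid" "n3 \<in> rigid"
  shows "case_letter n1 n2 n3 \<in> sections"
proof -
  have place: "(\<lambda>_. \<one>\<^bsub>M\<^esub>)(x := n) \<in> sections" if "n \<in> rigid" for n x
  proof -
    have "(\<lambda>_. \<one>\<^bsub>M\<^esub>)(L3 := n) \<circ> transpose x L3 = (\<lambda>_. \<one>\<^bsub>M\<^esub>)(x := n)"
      by (auto simp: fun_eq_iff transpose_def)
    then show ?thesis
      using that sections_permute[of "(\<lambda>_. \<one>\<^bsub>M\<^esub>)(L3 := n)" "transpose x L3"]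
      by (simp add: S3_iff_bij rigid_def)
  qed
  have "case_letter n1 n2 n3 =
      (\<lambda>x. ((\<lambda>_. \<one>\<^bsub>M\<^esub>)(L1 := n1)) x \<otimes>\<^bsub>M\<^esub> ((\<lambda>_. \<one>\<^bsub>M\<^esub>)(L2 := n2)) x \<otimes>\<^bsub>M\<^esub> ((\<lambda>_. \<one>\<^bsub>M\<^esub>)(L3 := n3)) x)"
    using assms[THEN rigid_mem] by (auto simp: fun_eq_iff split: letter.split)
  moreover have "\<dots> \<in> sections" by (intro sections_mult place assms)
  ultimately show ?thesis by simp
qed


section \<open>Stabilizer and sections as commensurable subgroups\<close>

abbreviation "M3 \<equiv> M \<times>\<times> M \<times>\<times> M"

interpretation M3: group M3 by (intro DirProd_group M.is_group)

definition level_stabilizer :: "(vertex \<Rightarrow> vertex) set" where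
  "level_stabilizer = (\<lambda>f. wreath f id) ` sections"

definition section_triples ::
  "((vertex \<Rightarrow> vertex) \<times> (vertex \<Rightarrow> vertex) \<times> (vertex \<Rightarrow> vertex)) set" where
  "section_triples = (\<lambda>f. (f L1, f L2, f L3)) ` sections"

lemma case_letter_eta: "case_letter (f L1) (f L2) (f L3) = f"
  by (auto simp: fun_eq_iff split: letter.split)

lemma section_triples_iff: "(g1, g2, g3) \<in> section_triples \<longleftrightarrow> case_letter g1 g2 g3 \<in> sections"
proof -
  have "(g1, g2, g3) = (\<lambda>f. (f L1, f L2, f L3)) (case_letter g1 g2 g3)" by simp
  then show ?thesis unfolding section_triples_def by (auto simp: case_letter_eta simp del: letter.case)
qed

lemma subgroup_level_stabilizer: "subgroup level_stabilizer M"
proof (rule M.subgroupI)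
  show "level_stabilizer \<subseteq> carrier M" by (auto simp: level_stabilizer_def sections_def)
  show "level_stabilizer \<noteq> {}" using sections_one by (auto simp: level_stabilizer_def)
  show "inv\<^bsub>M\<^esub> g \<in> level_stabilizer" if "g \<in> level_stabilizer" for g
    using that by (auto simp: level_stabilizer_def inv_wreath_id intro: sections_inv)
  show "g \<otimes>\<^bsub>M\<^esub> h \<in> level_stabilizer" if "g \<in> level_stabilizer" "h \<in> level_stabilizer" for g h
    using that by (auto simp: level_stabilizer_def wreath_mult_M intro: sections_mult)
qed

lemma subgroup_section_triples: "subgroup section_triples M3"
proof (rule M3.subgroupI)
  show "section_triples \<subseteq> carrier M3" by (auto simp: section_triples_def sections_mem)
  show "section_triples \<noteq> {}" using sections_one by (auto simp: section_triples_def)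
  show "inv\<^bsub>M3\<^esub> p \<in> section_triples" if p: "p \<in> section_triples" for p
  proof -
    obtain f where f: "f \<in> sections" "p = (f L1, f L2, f L3)" using p by (auto simp: section_triples_def)
    have "inv\<^bsub>M3\<^esub> p = (inv\<^bsub>M\<^esub> f L1, inv\<^bsub>M\<^esub> f L2, inv\<^bsub>M\<^esub> f L3)"
      using f sections_mem[OF f(1)]
      by (simp add: inv_DirProd M.is_group DirProd_group)
    then show ?thesis using sections_inv[OF f(1)] by (auto simp: section_triples_def)
  qed
  show "p \<otimes>\<^bsub>M3\<^esub> q \<in> section_triples" if pq: "p \<in> section_triples" "q \<in> section_triples" for p q
  proof -
    obtain f h where fh: "f \<in> sections" "p = (f L1, f L2, f L3)" "h \<in> sections" "q = (h L1, h L2, h L3)"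
      using pq by (auto simp: section_triples_def)
    then show ?thesis using sections_mult[OF fh(1,3)] by (auto simp: section_triples_def)
  qed
qed

text \<open>The rooted elements represent every action on the first level.\<close>

lemma finite_rcosets_level_stabilizer: "finite (rcosets\<^bsub>M\<^esub> level_stabilizer)"
proof (rule M.finite_rcosets_if_set_mult[OF subgroup_level_stabilizer])
  show "carrier M \<subseteq> level_stabilizer <#>\<^bsub>M\<^esub> rooted ` S3"
  proof
    fix g assume g: "g \<in> carrier M"
    then obtain f \<sigma> where f: "g = wreath f \<sigma>" "\<And>x. f x \<in> carrier M" "\<sigma> \<in> S3"
      using self_similar by blast
    have s: "bij \<sigma>" "inv_into UNIV \<sigma> \<in> S3" using f(3) by (simp_all add: S3_iff_bij bij_imp_bij_inv)
    have "wreath f id = g \<otimes>\<^bsub>M\<^esub> rooted (inv_into UNIV \<sigma>)"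
      using f s by (simp add: wreath_mult_rooted bij_is_inj)
    then have "f \<in> sections" using g s by (simp add: sections_def rooted_mem)
    moreover have "g = wreath f id \<otimes>\<^bsub>M\<^esub> rooted \<sigma>"
      using f by (simp add: wreath_mult_rooted)
    ultimately show "g \<in> level_stabilizer <#>\<^bsub>M\<^esub> rooted ` S3"
      using f(3) by (auto simp: level_stabilizer_def set_mult_def)
  qed
qed (auto simp: finite_S3 rooted_mem)

text \<open>The cube of \<open>rigid\<close> lies in \<open>section_triples\<close>, so the cube of a transversal of \<open>rigid\<close> in \<open>M\<close> meets
  all cosets.\<close>

lemma finite_rcosets_section_triples: "finite (rcosets\<^bsub>M3\<^esub> section_triples)"
proof -
  obtain R where R: "finite R" "R \<subseteq> carrier M" "carrier M \<subseteq> rigid <#>\<^bsub>M\<^esub> R"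
    by (rule rigid_transversal)
  show ?thesis
  proof (rule M3.finite_rcosets_if_set_mult[OF subgroup_section_triples])
    show "carrier M3 \<subseteq> section_triples <#>\<^bsub>M3\<^esub> (R \<times> R \<times> R)"
    proof
      fix p assume "p \<in> carrier M3"
      then obtain g1 g2 g3 where p: "p = (g1, g2, g3)" "g1 \<in> carrier M" "g2 \<in> carrier M" "g3 \<in> carrier M"
        by auto
      have dec: "\<exists>n\<in>rigid. \<exists>r\<in>R. g = n \<otimes>\<^bsub>M\<^esub> r" if "g \<in> carrier M" for g
        using subsetD[OF R(3) that] by (auto simp: set_mult_def)
      obtain n1 n2 n3 r1 r2 r3 where n: "n1 \<in> rigid" "n2 \<in> rigid" "n3 \<in> rigid"
        and r: "r1 \<in> R" "r2 \<in> R" "r3 \<in> R"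
        and g: "g1 = n1 \<otimes>\<^bsub>M\<^esub> r1" "g2 = n2 \<otimes>\<^bsub>M\<^esub> r2" "g3 = n3 \<otimes>\<^bsub>M\<^esub> r3"
        using dec[OF p(2)] dec[OF p(3)] dec[OF p(4)] by blast
      have "p = (n1, n2, n3) \<otimes>\<^bsub>M3\<^esub> (r1, r2, r3)" by (simp add: p g)
      moreover have "(n1, n2, n3) \<in> section_triples" 
        using rigid_cube_sections[OF n] by (simp add: section_triples_iff)
      ultimately show "p \<in> section_triples <#>\<^bsub>M3\<^esub> (R \<times> R \<times> R)" using r unfolding set_mult_def by blast
    qed
  qed (use R in auto)
qed

lemma section_triples_iso_level_stabilizer:
  "M3\<lparr>carrier := section_triples\<rparr> \<cong> M\<lparr>carrier := level_stabilizer\<rparr>"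
proof (rule is_isoI, rule isoI)
  let ?\<phi> = "\<lambda>(g1, g2, g3). wreath (case_letter g1 g2 g3) id"
  show "?\<phi> \<in> hom (M3\<lparr>carrier := section_triples\<rparr>) (M\<lparr>carrier := level_stabilizer\<rparr>)"
  proof (rule homI)
    show "?\<phi> p \<in> carrier (M\<lparr>carrier := level_stabilizer\<rparr>)"
      if "p \<in> carrier (M3\<lparr>carrier := section_triples\<rparr>)" for p
      using that by (cases p) (auto simp: section_triples_iff level_stabilizer_def)
    show "?\<phi> (p \<otimes>\<^bsub>M3\<lparr>carrier := section_triples\<rparr>\<^esub> q) = ?\<phi> p \<otimes>\<^bsub>M\<lparr>carrier := level_stabilizer\<rparr>\<^esub> ?\<phi> q"
      for p q
      by (cases p, cases q, simp add: wreath_mult_M wreath_eq_iff, rule ext, simp split: letter.split)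
  qed
  show "bij_betw ?\<phi> (carrier (M3\<lparr>carrier := section_triples\<rparr>)) (carrier (M\<lparr>carrier := level_stabilizer\<rparr>))"
  proof (rule bij_betw_imageI)
    show "inj_on ?\<phi> (carrier (M3\<lparr>carrier := section_triples\<rparr>))"
      by (auto simp: inj_on_def section_triples_def case_letter_eta wreath_eq_iff)
    show "?\<phi> ` carrier (M3\<lparr>carrier := section_triples\<rparr>) = carrier (M\<lparr>carrier := level_stabilizer\<rparr>)"
      by (simp add: section_triples_def level_stabilizer_def image_image case_letter_eta)
  qed
qed

theorem proposition3p6:
  shows "commensurable mother_group (mother_group \<times>\<times> mother_group \<times>\<times> mother_group)"
proof -
  have "M\<lparr>carrier := level_stabilizer\<rparr> \<cong> M3\<lparr>carrier := section_triples\<rparr>"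
    by (rule group.iso_sym[OF M3.subgroup_imp_group[OF subgroup_section_triples]
          section_triples_iso_level_stabilizer])
  then show ?thesis
    unfolding commensurable_def
    using subgroup_level_stabilizer finite_rcosets_level_stabilizer
      subgroup_section_triples finite_rcosets_section_triples by blast
qed

end
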